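(* Let $\varphi$ be a strongly convex function on $\mathbb R$, strictly increasing to $+\infty$, and let $(t_n)_n$ be the sequence defined by $\varphi(t_n)=2^n$. Suppose that $t_{n+1}-t_n\to\infty$ as $n\to\infty$. Then there exists a strongly convex function $\psi$ such that, with $\Phi=\varphi\circ\log$ and $\Psi=\psi\circ\log$, $$\operatorname{Alg}(\mathcal H_\Psi)\subset\operatorname{Mult}(\mathcal H_\Phi).$$
   Context: $\mathbb D$ is the open unit disk, $\mathbb T=\partial\mathbb D$ with normalized Lebesgue measure $m$, $\operatorname{Hol}(\mathbb D)$ is the space of holomorphic functions on $\mathbb D$, and $N^+$ is the Smirnov class on $\mathbb D$; functions in $N^+$ have non-tangential boundary values a.e. on $\mathbb T$, denoted by the same letter. A function $\varphi:\mathbb R\to[0,\infty)$ is strongly convex if it is convex, nondecreasing and $\lim_{t\to\infty}\varphi(t)/t=\infty$; one sets $\varphi(-\infty)=0$. With $\Phi=\varphi\circ\log$, the Hardy-Orlicz class is $\mathcal H_\Phi=\{f\in N^+:\int_{\mathbb T}\Phi(|f|)\,dm<\infty\}$. For $X\subset\operatorname{Hol}(\mathbb D)$, $\operatorname{Mult}(X)=\{g\in\operatorname{Hol}(\mathbb D): gf\in X \text{ for all } f\in X\}$, and $\operatorname{Alg}(X)$ is the algebra of functions generated by $X$. The numbers $t_n$ are defined for those $n\in\mathbb N$ with $2^n>\inf\varphi$, hence for all large $n$. *)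

theory Defs
  imports "HOL-Complex_Analysis.Complex_Analysis"
begin

abbreviation unit_disk :: "complex set" where
  "unit_disk \<equiv> ball 0 1"

text \<open>Functions on the disk are represented by total functions on \<^typ>\<open>complex\<close>; every class of
  functions below depends only on the values inside the disk.\<close>

definition circle_measure :: "complex measure" where
  "circle_measure = distr (uniform_measure lborel {0..2 * pi}) borel cis"

definition bounded_holomorphic :: "(complex \<Rightarrow> complex) \<Rightarrow> bool" where
  "bounded_holomorphic h \<longleftrightarrow> h holomorphic_on unit_disk \<and> bounded (h ` unit_disk)"

text \<open>Here \<open>u\<close> is the logarithm of the boundary modulus of the outer function.\<close>

definition outer_function :: "(complex \<Rightarrow> complex) \<Rightarrow> bool" where
  "outer_function h \<longleftrightarrow>
    (\<exists>(c::complex) (u::complex \<Rightarrow> real). norm c = 1 \<and> integrable circle_measure u \<and>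
      (\<forall>z\<in>unit_disk. h z =
        c * exp (\<integral>\<zeta>. ((\<zeta> + z) / (\<zeta> - z)) * complex_of_real (u \<zeta>) \<partial>circle_measure)))"

definition smirnov_class :: "(complex \<Rightarrow> complex) set" where
  "smirnov_class = {f. f holomorphic_on unit_disk \<and>
    (\<exists>h k. bounded_holomorphic h \<and> bounded_holomorphic k \<and> outer_function k \<and>
      (\<forall>z\<in>unit_disk. f z = h z / k z))}"

definition stolz_region :: "real \<Rightarrow> complex \<Rightarrow> complex set" where
  "stolz_region \<alpha> \<zeta> = {z \<in> unit_disk. norm (z - \<zeta>) < \<alpha> * (1 - norm z)}"

definition has_nontangential_limit :: "(complex \<Rightarrow> complex) \<Rightarrow> complex \<Rightarrow> complex \<Rightarrow> bool" where
  "has_nontangential_limit f \<zeta> l \<longleftrightarrow>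
    (\<forall>\<alpha>>1. (f \<longlongrightarrow> l) (at \<zeta> within stolz_region \<alpha> \<zeta>))"

text \<open>Boundary values are determined only up to null sets, so they are given by a relation; a
  Borel representative always exists when the limits exist almost everywhere.\<close>

definition has_boundary_values :: "(complex \<Rightarrow> complex) \<Rightarrow> (complex \<Rightarrow> complex) \<Rightarrow> bool" where
  "has_boundary_values f b \<longleftrightarrow> b \<in> borel_measurable circle_measure \<and>
    (AE \<zeta> in circle_measure. has_nontangential_limit f \<zeta> (b \<zeta>))"

definition strongly_convex :: "(real \<Rightarrow> real) \<Rightarrow> bool" where
  "strongly_convex \<phi> \<longleftrightarrow> (\<forall>t. 0 \<le> \<phi> t) \<and> convex_on UNIV \<phi> \<and> mono \<phi> \<and>
    filterlim (\<lambda>t. \<phi> t / t) at_top at_top"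

text \<open>The function \<open>\<phi> \<circ> log\<close> on \<open>[0, \<infinity>)\<close>, with the convention \<open>\<phi>(-\<infinity>) = 0\<close>.\<close>

definition comp_log :: "(real \<Rightarrow> real) \<Rightarrow> real \<Rightarrow> real" where
  "comp_log \<phi> x = (if x = 0 then 0 else \<phi> (ln x))"

text \<open>Every function in the Smirnov class has boundary values almost everywhere (Fatou), and they
  are almost everywhere unique, so the quantifier over \<open>b\<close> just names the boundary function.\<close>

definition hardy_orlicz :: "(real \<Rightarrow> real) \<Rightarrow> (complex \<Rightarrow> complex) set" where
  "hardy_orlicz \<Phi> = {f \<in> smirnov_class.
    \<exists>b. has_boundary_values f b \<and>
      (\<integral>\<^sup>+\<zeta>. ennreal (\<Phi> (norm (b \<zeta>))) \<partial>circle_measure) < \<infinity>}"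

definition multipliers :: "(complex \<Rightarrow> complex) set \<Rightarrow> (complex \<Rightarrow> complex) set" where
  "multipliers X = {g. g holomorphic_on unit_disk \<and> (\<forall>f\<in>X. (\<lambda>z. g z * f z) \<in> X)}"

definition function_algebra :: "(complex \<Rightarrow> complex) set \<Rightarrow> bool" where
  "function_algebra A \<longleftrightarrow> (\<lambda>z. 0) \<in> A \<and>
    (\<forall>f\<in>A. \<forall>g\<in>A. (\<lambda>z. f z + g z) \<in> A) \<and>
    (\<forall>c. \<forall>f\<in>A. (\<lambda>z. c * f z) \<in> A) \<and>
    (\<forall>f\<in>A. \<forall>g\<in>A. (\<lambda>z. f z * g z) \<in> A)"

text \<open>No unit is adjoined; the Hardy-Orlicz classes contain the constants anyway.\<close>

definition generated_algebra :: "(complex \<Rightarrow> complex) set \<Rightarrow> (complex \<Rightarrow> complex) set" where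
  "generated_algebra X = function_algebra hull X"

end

theory Submission
  imports Defs
begin

text \<open>
  The growth condition on \<open>t\<close> says that, for each fixed \<open>r\<close>, \<open>\<phi> (s + r) \<le> 4 * \<phi> s\<close> for all large
  \<open>s\<close>. Hence \<open>\<rho> r = (SUP s. \<phi> (s + r) - 4 * \<phi> s)\<close> is finite; as a supremum of convex nondecreasing
  functions it is again convex and nondecreasing, and it dominates \<open>\<phi> - 4 * \<phi> 0\<close>, so
  \<open>\<psi> = \<rho> + 4 * \<phi> 0\<close> is strongly convex. By construction \<open>\<phi> (s + r) \<le> 4 * \<phi> s + \<psi> r\<close>; with
  \<open>s = ln \<bar>f\<bar>\<close> and \<open>r = ln \<bar>g\<bar>\<close> this makes the class of \<open>\<psi>\<close> multiply the class of \<open>\<phi>\<close> into itself.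
  With \<open>r = ln 2\<close> it shows that the class of \<open>\<phi>\<close> is closed under sums, so its multipliers form an
  algebra.
\<close>

section \<open>Circle measure and outer functions\<close>

lemma sets_circle_measure [measurable_cong]: "sets circle_measure = sets borel"
  by (simp add: circle_measure_def)

lemma cis_measurable [measurable]: "cis \<in> borel_measurable borel"
  by (intro borel_measurable_continuous_onI continuous_intros)

lemma emeasure_circle_measure: "emeasure circle_measure (space circle_measure) = 1"
  by (simp add: circle_measure_def emeasure_distr ennreal_divide_self)

lemma AE_circle_measure_norm: "AE \<zeta> in circle_measure. norm \<zeta> = 1"
  unfolding circle_measure_def by (subst AE_distr_iff) auto

text \<open>On the unit circle the numerator has modulus at most 2 and the denominator at least
  \<open>1 - norm z\<close>, so the kernel is bounded for fixed \<open>z\<close>. This is what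
  permits splitting the integral of a sum in \<open>outer_function_mult\<close>.\<close>

lemma integrable_herglotz_kernel:
  fixes u :: "complex \<Rightarrow> real"
  assumes "integrable circle_measure u" and "z \<in> unit_disk"
  shows "integrable circle_measure (\<lambda>\<zeta>. ((\<zeta> + z) / (\<zeta> - z)) * complex_of_real (u \<zeta>))"
proof (rule Bochner_Integration.integrable_bound)
  have z: "norm z < 1" using assms(2) by simp
  show "integrable circle_measure (\<lambda>\<zeta>. (2 / (1 - norm z)) * u \<zeta>)"
    using assms(1) by simp
  have [measurable]: "u \<in> borel_measurable circle_measure"
    using assms(1) by auto
  show "(\<lambda>\<zeta>. ((\<zeta> + z) / (\<zeta> - z)) * complex_of_real (u \<zeta>)) \<in> borel_measurable circle_measure"
    by measurable
  show "AE \<zeta> in circle_measure. norm (((\<zeta> + z) / (\<zeta> - z)) * complex_of_real (u \<zeta>))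
      \<le> norm ((2 / (1 - norm z)) * u \<zeta>)"
    using AE_circle_measure_norm
  proof eventually_elim
    case (elim \<zeta>)
    have "norm (\<zeta> + z) \<le> 2" using norm_triangle_ineq[of \<zeta> z] elim z by simp
    moreover have "1 - norm z \<le> norm (\<zeta> - z)" using norm_triangle_ineq2[of \<zeta> z] elim by simp
    ultimately have "norm ((\<zeta> + z) / (\<zeta> - z)) \<le> 2 / (1 - norm z)"
      unfolding norm_divide using z by (intro frac_le) auto
    then show ?case
      using z mult_right_mono[of "norm ((\<zeta> + z) / (\<zeta> - z))" "2 / (1 - norm z)" "\<bar>u \<zeta>\<bar>"]
      by (simp only: norm_mult norm_of_real) simp
  qed
qed

text \<open>The logarithms of the boundary moduli add: \<open>u + v\<close> is again integrable, and
  the exponential turns the sum of the two integrals into a product.\<close>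

lemma outer_function_mult:
  assumes "outer_function h" and "outer_function k"
  shows "outer_function (\<lambda>z. h z * k z)"
proof -
  let ?I = "\<lambda>u z. \<integral>\<zeta>. ((\<zeta> + z) / (\<zeta> - z)) * complex_of_real (u \<zeta>) \<partial>circle_measure"
  obtain c u where u: "norm c = 1" "integrable circle_measure u"
      "\<And>z. z \<in> unit_disk \<Longrightarrow> h z = c * exp (?I u z)"
    using assms(1) unfolding outer_function_def by blast
  obtain d v where v: "norm d = 1" "integrable circle_measure v"
      "\<And>z. z \<in> unit_disk \<Longrightarrow> k z = d * exp (?I v z)"
    using assms(2) unfolding outer_function_def by blast
  have "h z * k z = (c * d) * exp (?I (\<lambda>\<zeta>. u \<zeta> + v \<zeta>) z)" if z: "z \<in> unit_disk" for z
  proof -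
    have "?I (\<lambda>\<zeta>. u \<zeta> + v \<zeta>) z = ?I u z + ?I v z"
      using Bochner_Integration.integral_add
        [OF integrable_herglotz_kernel[OF u(2) z] integrable_herglotz_kernel[OF v(2) z]]
      by (simp add: distrib_left)
    then show ?thesis
      using u(3)[OF z] v(3)[OF z] by (simp add: exp_add)
  qed
  moreover have "norm (c * d) = 1" using u v by (simp add: norm_mult)
  moreover have "integrable circle_measure (\<lambda>\<zeta>. u \<zeta> + v \<zeta>)" using u v by simp
  ultimately show ?thesis
    unfolding outer_function_def by blast
qed

lemma outer_function_nonzero: "outer_function k \<Longrightarrow> z \<in> unit_disk \<Longrightarrow> k z \<noteq> 0"
  unfolding outer_function_def by force

lemma outer_function_one: "outer_function (\<lambda>z. 1)"
  unfolding outer_function_def by (intro exI[of _ 1] exI[of _ "\<lambda>_. 0"]) simp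

section \<open>Algebraic closure of the Smirnov class\<close>

lemma bounded_holomorphic_add:
  assumes "bounded_holomorphic h" and "bounded_holomorphic k"
  shows "bounded_holomorphic (\<lambda>z. h z + k z)"
  using assms unfolding bounded_holomorphic_def
  by (auto intro: holomorphic_on_add bounded_plus_comp)

lemma bounded_holomorphic_mult:
  assumes "bounded_holomorphic h" and "bounded_holomorphic k"
  shows "bounded_holomorphic (\<lambda>z. h z * k z)"
proof -
  obtain B C where "\<And>z. z \<in> unit_disk \<Longrightarrow> norm (h z) \<le> B" "\<And>z. z \<in> unit_disk \<Longrightarrow> norm (k z) \<le> C"
    using assms unfolding bounded_holomorphic_def bounded_iff by blast
  then have "norm (h z * k z) \<le> B * C" if "z \<in> unit_disk" for z
    unfolding norm_mult using that by (meson mult_mono' norm_ge_zero)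
  then have "bounded ((\<lambda>z. h z * k z) ` unit_disk)"
    unfolding bounded_iff by blast
  then show ?thesis
    using assms unfolding bounded_holomorphic_def by (auto intro: holomorphic_on_mult)
qed

lemma bounded_holomorphic_const: "bounded_holomorphic (\<lambda>z. c)"
  unfolding bounded_holomorphic_def by (auto simp: image_constant_conv)

lemma smirnov_class_const: "(\<lambda>z. c) \<in> smirnov_class"
  unfolding smirnov_class_def
  using bounded_holomorphic_const outer_function_one by force

lemma smirnov_class_mult:
  assumes "f \<in> smirnov_class" and "g \<in> smirnov_class"
  shows "(\<lambda>z. f z * g z) \<in> smirnov_class"
proof -
  obtain h k where f: "bounded_holomorphic h" "bounded_holomorphic k" "outer_function k"
      "\<And>z. z \<in> unit_disk \<Longrightarrow> f z = h z / k z"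
    using assms(1) unfolding smirnov_class_def by blast
  obtain p q where g: "bounded_holomorphic p" "bounded_holomorphic q" "outer_function q"
      "\<And>z. z \<in> unit_disk \<Longrightarrow> g z = p z / q z"
    using assms(2) unfolding smirnov_class_def by blast
  have "\<forall>z\<in>unit_disk. f z * g z = (h z * p z) / (k z * q z)"
    using f(4) g(4) by simp
  moreover have "(\<lambda>z. f z * g z) holomorphic_on unit_disk"
    using assms unfolding smirnov_class_def by (auto intro: holomorphic_on_mult)
  ultimately show ?thesis
    unfolding smirnov_class_def
    using bounded_holomorphic_mult[OF f(1) g(1)] bounded_holomorphic_mult[OF f(2) g(2)]
      outer_function_mult[OF f(3) g(3)] by blast
qed

text \<open>Quotients are added over the common denominator \<open>k z * q z\<close>, which is
  legitimate because outer functions have no zeros in the disk and their products are outer.\<close>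

lemma smirnov_class_add:
  assumes "f \<in> smirnov_class" and "g \<in> smirnov_class"
  shows "(\<lambda>z. f z + g z) \<in> smirnov_class"
proof -
  obtain h k where f: "bounded_holomorphic h" "bounded_holomorphic k" "outer_function k"
      "\<And>z. z \<in> unit_disk \<Longrightarrow> f z = h z / k z"
    using assms(1) unfolding smirnov_class_def by blast
  obtain p q where g: "bounded_holomorphic p" "bounded_holomorphic q" "outer_function q"
      "\<And>z. z \<in> unit_disk \<Longrightarrow> g z = p z / q z"
    using assms(2) unfolding smirnov_class_def by blast
  have "\<forall>z\<in>unit_disk. f z + g z = (h z * q z + p z * k z) / (k z * q z)"
    using f(4) g(4) outer_function_nonzero[OF f(3)] outer_function_nonzero[OF g(3)]
    by (simp add: add_frac_eq)
  moreover have "(\<lambda>z. f z + g z) holomorphic_on unit_disk"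
    using assms unfolding smirnov_class_def by (auto intro: holomorphic_on_add)
  moreover have "bounded_holomorphic (\<lambda>z. h z * q z + p z * k z)"
    using f g by (intro bounded_holomorphic_add bounded_holomorphic_mult)
  ultimately show ?thesis
    unfolding smirnov_class_def
    using bounded_holomorphic_mult[OF f(2) g(2)] outer_function_mult[OF f(3) g(3)] by blast
qed

section \<open>Arithmetic of boundary values\<close>

lemma has_boundary_valuesD: "has_boundary_values f b \<Longrightarrow> b \<in> borel_measurable circle_measure"
  by (simp add: has_boundary_values_def)

lemma has_boundary_values_const: "has_boundary_values (\<lambda>z. c) (\<lambda>z. c)"
  unfolding has_boundary_values_def has_nontangential_limit_def by simp

lemma has_boundary_values_add:
  assumes "has_boundary_values f a" and "has_boundary_values g b"
  shows "has_boundary_values (\<lambda>z. f z + g z) (\<lambda>z. a z + b z)"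
proof -
  have "AE \<zeta> in circle_measure. has_nontangential_limit (\<lambda>z. f z + g z) \<zeta> (a \<zeta> + b \<zeta>)"
    using assms[unfolded has_boundary_values_def, THEN conjunct2]
    by eventually_elim (auto simp: has_nontangential_limit_def intro: tendsto_add)
  then show ?thesis
    using assms unfolding has_boundary_values_def by auto
qed

lemma has_boundary_values_mult:
  assumes "has_boundary_values f a" and "has_boundary_values g b"
  shows "has_boundary_values (\<lambda>z. f z * g z) (\<lambda>z. a z * b z)"
proof -
  have "AE \<zeta> in circle_measure. has_nontangential_limit (\<lambda>z. f z * g z) \<zeta> (a \<zeta> * b \<zeta>)"
    using assms[unfolded has_boundary_values_def, THEN conjunct2]
    by eventually_elim (auto simp: has_nontangential_limit_def intro: tendsto_mult)
  then show ?thesis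
    using assms unfolding has_boundary_values_def by auto
qed

section \<open>Products and sums in Hardy-Orlicz classes\<close>

lemma strongly_convex_measurable:
  assumes "strongly_convex \<phi>"
  shows "\<phi> \<in> borel_measurable borel"
  using assms unfolding strongly_convex_def by (intro borel_measurable_mono) simp

lemma comp_log_measurable:
  assumes "strongly_convex \<phi>"
  shows "comp_log \<phi> \<in> borel_measurable borel"
  using strongly_convex_measurable[OF assms] unfolding comp_log_def by measurable

lemma comp_log_nonneg: "strongly_convex \<phi> \<Longrightarrow> 0 \<le> comp_log \<phi> x"
  by (simp add: comp_log_def strongly_convex_def)

text \<open>The convention at 0 does not break monotonicity, because \<phi> is nonnegative.\<close>

lemma comp_log_mono:
  assumes "strongly_convex \<phi>" and "0 \<le> x" and "x \<le> y"
  shows "comp_log \<phi> x \<le> comp_log \<phi> y"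
  using assms by (auto simp: comp_log_def strongly_convex_def mono_def)

lemma hardy_orlicz_const: "(\<lambda>z. c) \<in> hardy_orlicz (comp_log \<phi>)"
proof -
  have "(\<integral>\<^sup>+\<zeta>. ennreal (comp_log \<phi> (norm c)) \<partial>circle_measure) < \<infinity>"
    by (simp add: emeasure_circle_measure)
  then show ?thesis
    unfolding hardy_orlicz_def
    using smirnov_class_const has_boundary_values_const[of c] by blast
qed

text \<open>Shared by products and sums: it reduces membership in a class to a pointwise estimate on
  boundary values.\<close>

lemma nn_integral_comp_log_less_top:
  assumes "strongly_convex \<phi>" and "strongly_convex \<psi>"
    and "a \<in> borel_measurable circle_measure" and "b \<in> borel_measurable circle_measure"
    and "(\<integral>\<^sup>+\<zeta>. ennreal (comp_log \<phi> (norm (a \<zeta>))) \<partial>circle_measure) < \<infinity>"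
    and "(\<integral>\<^sup>+\<zeta>. ennreal (comp_log \<psi> (norm (b \<zeta>))) \<partial>circle_measure) < \<infinity>"
    and "0 \<le> K" "0 \<le> L"
    and bound: "\<And>\<zeta>. F \<zeta> \<le> K * comp_log \<phi> (norm (a \<zeta>)) + L * comp_log \<psi> (norm (b \<zeta>))"
  shows "(\<integral>\<^sup>+\<zeta>. ennreal (F \<zeta>) \<partial>circle_measure) < \<infinity>"
proof -
  note [measurable] = assms(3,4) comp_log_measurable[OF assms(1)] comp_log_measurable[OF assms(2)]
  have "(\<integral>\<^sup>+\<zeta>. ennreal (F \<zeta>) \<partial>circle_measure) \<le>
      (\<integral>\<^sup>+\<zeta>. ennreal K * ennreal (comp_log \<phi> (norm (a \<zeta>))) +
        ennreal L * ennreal (comp_log \<psi> (norm (b \<zeta>))) \<partial>circle_measure)"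
    using assms(7,8) comp_log_nonneg[OF assms(1)] comp_log_nonneg[OF assms(2)]
    by (intro nn_integral_mono)
      (simp add: ennreal_mult[symmetric] ennreal_plus[symmetric] ennreal_leI bound
        del: ennreal_plus)
  also have "\<dots> = ennreal K * (\<integral>\<^sup>+\<zeta>. ennreal (comp_log \<phi> (norm (a \<zeta>))) \<partial>circle_measure) +
      ennreal L * (\<integral>\<^sup>+\<zeta>. ennreal (comp_log \<psi> (norm (b \<zeta>))) \<partial>circle_measure)"
    by (simp add: nn_integral_add nn_integral_cmult)
  also have "\<dots> < \<infinity>"
    using assms(5,6) by (simp add: ennreal_mult_less_top)
  finally show ?thesis .
qed

lemma hardy_orlicz_mult:
  assumes "strongly_convex \<phi>" and "strongly_convex \<psi>"
    and "0 \<le> K" and split: "\<And>s r. \<phi> (s + r) \<le> K * \<phi> s + \<psi> r"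
    and "f \<in> hardy_orlicz (comp_log \<phi>)" and "g \<in> hardy_orlicz (comp_log \<psi>)"
  shows "(\<lambda>z. g z * f z) \<in> hardy_orlicz (comp_log \<phi>)"
proof -
  obtain a where f: "f \<in> smirnov_class" "has_boundary_values f a"
      "(\<integral>\<^sup>+\<zeta>. ennreal (comp_log \<phi> (norm (a \<zeta>))) \<partial>circle_measure) < \<infinity>"
    using assms(5) unfolding hardy_orlicz_def by blast
  obtain b where g: "g \<in> smirnov_class" "has_boundary_values g b"
      "(\<integral>\<^sup>+\<zeta>. ennreal (comp_log \<psi> (norm (b \<zeta>))) \<partial>circle_measure) < \<infinity>"
    using assms(6) unfolding hardy_orlicz_def by blast
  have "comp_log \<phi> (norm (b \<zeta> * a \<zeta>)) \<le>
      K * comp_log \<phi> (norm (a \<zeta>)) + 1 * comp_log \<psi> (norm (b \<zeta>))" for \<zeta>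
  \<comment> \<open>The logarithm of the product splits only when both factors are nonzero;
    otherwise the left side is 0 by the convention in \<open>comp_log\<close>.\<close>
  proof (cases "a \<zeta> = 0 \<or> b \<zeta> = 0")
    case True
    then have "comp_log \<phi> (norm (b \<zeta> * a \<zeta>)) = 0"
      by (auto simp: comp_log_def)
    then show ?thesis
      using comp_log_nonneg[OF assms(1)] comp_log_nonneg[OF assms(2)] assms(3) by simp
  next
    case False
    then show ?thesis
      using split[of "ln (norm (a \<zeta>))" "ln (norm (b \<zeta>))"]
      by (simp add: comp_log_def norm_mult ln_mult add.commute)
  qed
  then have "(\<integral>\<^sup>+\<zeta>. ennreal (comp_log \<phi> (norm (b \<zeta> * a \<zeta>))) \<partial>circle_measure) < \<infinity>"
    by (rule nn_integral_comp_log_less_top[OF assms(1,2)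
        has_boundary_valuesD[OF f(2)] has_boundary_valuesD[OF g(2)] f(3) g(3) assms(3) zero_le_one])
  then show ?thesis
    unfolding hardy_orlicz_def
    using smirnov_class_mult[OF g(1) f(1)] has_boundary_values_mult[OF g(2) f(2)] by blast
qed

text \<open>The sum is the mean of \<open>2 * f\<close> and \<open>2 * g\<close>. The modulus of a
  mean is at most the larger modulus, and at the larger modulus \<open>comp_log\<close> takes one of
  two nonnegative values, hence is at most their sum.\<close>

lemma hardy_orlicz_add:
  assumes "strongly_convex \<phi>"
    and double: "\<And>f. f \<in> hardy_orlicz (comp_log \<phi>) \<Longrightarrow> (\<lambda>z. 2 * f z) \<in> hardy_orlicz (comp_log \<phi>)"
    and "f \<in> hardy_orlicz (comp_log \<phi>)" and "g \<in> hardy_orlicz (comp_log \<phi>)"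
  shows "(\<lambda>z. f z + g z) \<in> hardy_orlicz (comp_log \<phi>)"
proof -
  obtain a where f: "(\<lambda>z. 2 * f z) \<in> smirnov_class" "has_boundary_values (\<lambda>z. 2 * f z) a"
      "(\<integral>\<^sup>+\<zeta>. ennreal (comp_log \<phi> (norm (a \<zeta>))) \<partial>circle_measure) < \<infinity>"
    using double[OF assms(3)] unfolding hardy_orlicz_def by blast
  obtain b where g: "(\<lambda>z. 2 * g z) \<in> smirnov_class" "has_boundary_values (\<lambda>z. 2 * g z) b"
      "(\<integral>\<^sup>+\<zeta>. ennreal (comp_log \<phi> (norm (b \<zeta>))) \<partial>circle_measure) < \<infinity>"
    using double[OF assms(4)] unfolding hardy_orlicz_def by blast
  have sum_eq: "(\<lambda>z. f z + g z) = (\<lambda>z. (1/2) * (2 * f z + 2 * g z))"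
    by (simp add: distrib_left)
  have "comp_log \<phi> (norm ((1/2) * (a \<zeta> + b \<zeta>))) \<le>
      1 * comp_log \<phi> (norm (a \<zeta>)) + 1 * comp_log \<phi> (norm (b \<zeta>))" for \<zeta>
  proof -
    have "norm ((1/2) * (a \<zeta> + b \<zeta>)) \<le> max (norm (a \<zeta>)) (norm (b \<zeta>))"
      unfolding norm_mult using norm_triangle_ineq[of "a \<zeta>" "b \<zeta>"] by (simp add: norm_divide)
    then have "comp_log \<phi> (norm ((1/2) * (a \<zeta> + b \<zeta>))) \<le>
        comp_log \<phi> (max (norm (a \<zeta>)) (norm (b \<zeta>)))"
      by (intro comp_log_mono[OF assms(1)]) auto
    then show ?thesis
      using comp_log_nonneg[OF assms(1), of "norm (a \<zeta>)"]
        comp_log_nonneg[OF assms(1), of "norm (b \<zeta>)"]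
      by (auto simp: max_def split: if_splits)
  qed
  then have "(\<integral>\<^sup>+\<zeta>. ennreal (comp_log \<phi> (norm ((1/2) * (a \<zeta> + b \<zeta>)))) \<partial>circle_measure) < \<infinity>"
    by (rule nn_integral_comp_log_less_top[OF assms(1,1)
        has_boundary_valuesD[OF f(2)] has_boundary_valuesD[OF g(2)] f(3) g(3)
        zero_le_one zero_le_one])
  moreover have "has_boundary_values (\<lambda>z. (1/2) * (2 * f z + 2 * g z)) (\<lambda>z. (1/2) * (a z + b z))"
    by (intro has_boundary_values_mult has_boundary_values_add has_boundary_values_const f g)
  moreover have "(\<lambda>z. (1/2) * (2 * f z + 2 * g z)) \<in> smirnov_class"
    by (intro smirnov_class_mult smirnov_class_add smirnov_class_const f g)
  ultimately show ?thesis
    unfolding hardy_orlicz_def sum_eq by blast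
qed

section \<open>The algebra of multipliers\<close>

text \<open>Products come from multiplying twice in succession, sums from distributivity and closure
  of \<open>X\<close> under addition. Constant multipliers provide the zero function and, through
  products, the scalar multiples.\<close>

lemma function_algebra_multipliers:
  assumes "\<And>c. (\<lambda>z. c) \<in> multipliers X"
    and add: "\<And>f g. f \<in> X \<Longrightarrow> g \<in> X \<Longrightarrow> (\<lambda>z. f z + g z) \<in> X"
  shows "function_algebra (multipliers X)"
proof -
  have mult: "(\<lambda>z. f z * g z) \<in> multipliers X"
    if "f \<in> multipliers X" "g \<in> multipliers X" for f g
  proof -
    have "(\<lambda>z. f z * g z * h z) \<in> X" if "h \<in> X" for h
    proof -
      have "(\<lambda>z. g z * h z) \<in> X"
        using \<open>g \<in> multipliers X\<close> that unfolding multipliers_def by blast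
      then have "(\<lambda>z. f z * (g z * h z)) \<in> X"
        using \<open>f \<in> multipliers X\<close> unfolding multipliers_def by simp
      then show ?thesis by (simp add: mult.assoc)
    qed
    then show ?thesis
      using that unfolding multipliers_def by (auto intro: holomorphic_on_mult)
  qed
  have "(\<lambda>z. f z + g z) \<in> multipliers X"
    if "f \<in> multipliers X" "g \<in> multipliers X" for f g
    using that unfolding multipliers_def
    by (auto intro: holomorphic_on_add simp: distrib_right add)
  then show ?thesis
    unfolding function_algebra_def using assms(1) mult by blast
qed

section \<open>Growth condition and convex majorant\<close>

text \<open>If \<open>2 ^ n \<le> \<phi> s < 2 ^ Suc n\<close>, then \<open>s\<close> lies below
  \<open>t (Suc n)\<close>. Once the gaps exceed \<open>r\<close>, the shift by \<open>r\<close>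
  passes at most one further gap, so the value is at most \<open>2 ^ (n + 2)\<close>.\<close>

lemma eventually_shift_le:
  fixes \<phi> :: "real \<Rightarrow> real" and t :: "nat \<Rightarrow> real"
  assumes "strict_mono \<phi>"
    and t: "eventually (\<lambda>n. \<phi> (t n) = 2 ^ n) sequentially"
    and gaps: "filterlim (\<lambda>n. t (Suc n) - t n) at_top sequentially"
  shows "eventually (\<lambda>s. \<phi> (s + r) \<le> 4 * \<phi> s) at_top"
proof -
  have "eventually (\<lambda>n. r \<le> t (Suc n) - t n) sequentially"
    using gaps by (simp add: filterlim_at_top)
  with t obtain N where N: "\<And>n. n \<ge> N \<Longrightarrow> \<phi> (t n) = 2 ^ n \<and> r \<le> t (Suc n) - t n"
    unfolding eventually_sequentially by (metis nat_le_linear order_trans)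
  have "\<phi> (s + r) \<le> 4 * \<phi> s" if "s \<ge> t N" for s
  proof -
    let ?P = "\<lambda>n. \<phi> s < 2 ^ n"
    \<comment> \<open>The first power of 2 above \<open>\<phi> s\<close>. Since
      \<open>s \<ge> t N\<close>, it comes strictly after \<open>N\<close>, so its predecessor
      \<open>n\<close> is still at least \<open>N\<close>.\<close>
    define m where "m = (LEAST n. ?P n)"
    obtain m0 where "?P m0"
      using real_arch_pow[of 2 "\<phi> s"] by auto
    then have m: "?P m" unfolding m_def by (rule LeastI)
    have "2 ^ N \<le> \<phi> s"
      using N[of N] that strict_mono_less_eq[OF assms(1), of "t N" s] by simp
    then have "(2::real) ^ N < 2 ^ m" using m by linarith
    then have "N < m" by simp
    then obtain n where n: "m = Suc n" "n \<ge> N" by (metis less_Suc_eq_le not0_implies_Suc not_less0)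
    have "\<not> ?P n" using not_less_Least[of n ?P] n(1) by (simp add: m_def)
    have "\<phi> s < \<phi> (t m)" using m N[of m] n by simp
    then have "s < t m" using strict_mono_less[OF assms(1)] by blast
    then have "s + r \<le> t (Suc m)" using N[of m] n by simp
    then have "\<phi> (s + r) \<le> \<phi> (t (Suc m))" using strict_mono_less_eq[OF assms(1)] by blast
    \<comment> \<open>Here \<open>Suc m = n + 2\<close>, which is the origin of the factor
      4.\<close>
    also have "\<dots> = 4 * 2 ^ n" using N[of "Suc m"] n by simp
    also have "\<dots> \<le> 4 * \<phi> s" using \<open>\<not> ?P n\<close> by simp
    finally show ?thesis .
  qed
  then show ?thesis
    unfolding eventually_at_top_linorder by blast
qed

lemma convex_on_shift:
  fixes \<phi> :: "real \<Rightarrow> real"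
  assumes "convex_on UNIV \<phi>"
  shows "convex_on UNIV (\<lambda>r. \<phi> (s + r))"
proof (rule convex_onI)
  fix u x y :: real
  assume "0 < u" "u < 1"
  then show "\<phi> (s + ((1 - u) *\<^sub>R x + u *\<^sub>R y)) \<le> (1 - u) * \<phi> (s + x) + u * \<phi> (s + y)"
    using convex_onD[OF assms, of u "s + x" "s + y"] by (simp add: algebra_simps)
qed simp

text \<open>The smallest candidate for \<psi> is the supremum over \<open>s\<close> of
  \<open>\<phi> (s + r) - K * \<phi> s\<close>. The eventual inequality makes it finite, and a
  constant is added to ensure nonnegativity.\<close>

lemma exists_strongly_convex_shift_majorant:
  fixes \<phi> :: "real \<Rightarrow> real"
  assumes "strongly_convex \<phi>" and "0 \<le> K"
    and shift: "\<And>r. eventually (\<lambda>s. \<phi> (s + r) \<le> K * \<phi> s) at_top"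
  shows "\<exists>\<psi>. strongly_convex \<psi> \<and> (\<forall>s r. \<phi> (s + r) \<le> K * \<phi> s + \<psi> r)"
proof -
  have nonneg: "0 \<le> \<phi> s" and mono: "mono \<phi>" and convex: "convex_on UNIV \<phi>"
    and lim: "filterlim (\<lambda>t. \<phi> t / t) at_top at_top" for s
    using assms(1) unfolding strongly_convex_def by auto
  define \<rho> where "\<rho> r = (SUP s. \<phi> (s + r) - K * \<phi> s)" for r
  have bdd: "bdd_above (range (\<lambda>s. \<phi> (s + r) - K * \<phi> s))" for r
  proof -
    obtain S where S: "\<And>s. s \<ge> S \<Longrightarrow> \<phi> (s + r) \<le> K * \<phi> s"
      using shift[of r] unfolding eventually_at_top_linorder by blast
    \<comment> \<open>From \<open>S\<close> on the difference is nonpositive; before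
      \<open>S\<close> the subtracted term is dropped and monotonicity is used.\<close>
    have "\<phi> (s + r) - K * \<phi> s \<le> \<phi> (S + r)" for s
    proof (cases "s \<ge> S")
      case True
      then show ?thesis using S[of s] nonneg[of "S + r"] by linarith
    next
      case False
      then have "\<phi> (s + r) \<le> \<phi> (S + r)" using monoD[OF mono] by simp
      then show ?thesis using mult_nonneg_nonneg[OF \<open>0 \<le> K\<close> nonneg[of s]] by linarith
    qed
    then show ?thesis by (intro bdd_aboveI2)
  qed
  have upper: "\<phi> (s + r) - K * \<phi> s \<le> \<rho> r" for s r
    unfolding \<rho>_def by (rule cSUP_upper[OF UNIV_I bdd])
  \<comment> \<open>With this constant the bound \<open>upper\<close> at \<open>s = 0\<close> reads
    \<open>\<phi> r \<le> \<psi> r\<close>, from which \<psi> inherits both nonnegativity and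
    superlinear growth.\<close>
  define \<psi> where "\<psi> r = \<rho> r + K * \<phi> 0" for r
  have ge: "\<phi> r \<le> \<psi> r" for r using upper[of 0 r] by (simp add: \<psi>_def)
  have "convex_on UNIV \<rho>"
  proof (rule convex_onI)
    fix u x y :: real
    assume u: "0 < u" "u < 1"
    have "\<phi> (s + ((1 - u) *\<^sub>R x + u *\<^sub>R y)) - K * \<phi> s \<le> (1 - u) * \<rho> x + u * \<rho> y" for s
    proof -
      have "\<phi> (s + ((1 - u) *\<^sub>R x + u *\<^sub>R y)) - K * \<phi> s \<le>
          (1 - u) * \<phi> (s + x) + u * \<phi> (s + y) - K * \<phi> s"
        using convex_onD[OF convex_on_shift[OF convex], of u x y s] u by simp
      \<comment> \<open>The term \<open>K * \<phi> s\<close> does not depend on the argument of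
        \<rho> and is distributed over the weights, whose sum is 1.\<close>
      also have "\<dots> = (1 - u) * (\<phi> (s + x) - K * \<phi> s) + u * (\<phi> (s + y) - K * \<phi> s)"
        by (simp add: algebra_simps)
      also have "\<dots> \<le> (1 - u) * \<rho> x + u * \<rho> y"
        using u by (intro add_mono mult_left_mono upper) auto
      finally show ?thesis .
    qed
    then show "\<rho> ((1 - u) *\<^sub>R x + u *\<^sub>R y) \<le> (1 - u) * \<rho> x + u * \<rho> y"
      unfolding \<rho>_def[of "(1 - u) *\<^sub>R x + u *\<^sub>R y"] by (intro cSUP_least) auto
  qed simp
  then have "convex_on UNIV \<psi>"
    unfolding \<psi>_def by (intro convex_on_add) (auto simp: convex_on_def distrib_right[symmetric])
  moreover have "mono \<psi>"
  proof (rule monoI)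
    fix x y :: real
    assume "x \<le> y"
    then have "\<phi> (s + x) - K * \<phi> s \<le> \<rho> y" for s
      using upper[of s y] monoD[OF mono, of "s + x" "s + y"] by simp
    then have "\<rho> x \<le> \<rho> y"
      unfolding \<rho>_def[of x] by (intro cSUP_least) auto
    then show "\<psi> x \<le> \<psi> y" by (simp add: \<psi>_def)
  qed
  moreover have "filterlim (\<lambda>r. \<psi> r / r) at_top at_top"
  proof (rule filterlim_at_top_mono[OF lim])
    show "eventually (\<lambda>r. \<phi> r / r \<le> \<psi> r / r) at_top"
      using eventually_gt_at_top[of 0] by eventually_elim (simp add: divide_right_mono ge)
  qed
  moreover have "0 \<le> \<psi> r" for r using nonneg[of r] ge[of r] by linarith
  moreover have "\<phi> (s + r) \<le> K * \<phi> s + \<psi> r" for s r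
    using upper[of s r] mult_nonneg_nonneg[OF \<open>0 \<le> K\<close> nonneg[of 0]] by (simp add: \<psi>_def)
  ultimately show ?thesis
    unfolding strongly_convex_def by blast
qed

theorem corollary5p3:
  fixes \<phi> :: "real \<Rightarrow> real" and t :: "nat \<Rightarrow> real"
  assumes "strongly_convex \<phi>"
    and "strict_mono \<phi>"
    and "filterlim \<phi> at_top at_top"
    and "\<And>n. (INF s. \<phi> s) < 2 ^ n \<Longrightarrow> \<phi> (t n) = 2 ^ n"
    and "filterlim (\<lambda>n. t (Suc n) - t n) at_top sequentially"
  shows "\<exists>\<psi>. strongly_convex \<psi> \<and>
    generated_algebra (hardy_orlicz (comp_log \<psi>)) \<subseteq> multipliers (hardy_orlicz (comp_log \<phi>))"
proof -
  let ?X = "hardy_orlicz (comp_log \<phi>)"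
  \<comment> \<open>Any value of \<phi> bounds its infimum from above, so from \<open>n0\<close> on
    the defining equation of \<open>t n\<close> is available.\<close>
  obtain n0 where "\<phi> 0 < 2 ^ n0"
    using real_arch_pow[of 2 "\<phi> 0"] by auto
  moreover have "(INF s. \<phi> s) \<le> \<phi> 0"
    using assms(1) unfolding strongly_convex_def
    by (intro cINF_lower bdd_belowI2[of _ 0]) auto
  ultimately have "(INF s. \<phi> s) < 2 ^ n" if "n \<ge> n0" for n
    using power_increasing[OF that, of "2::real"] by linarith
  then have "eventually (\<lambda>n. \<phi> (t n) = 2 ^ n) sequentially"
    unfolding eventually_sequentially using assms(4) by blast
  then obtain \<psi> where \<psi>: "strongly_convex \<psi>" "\<And>s r. \<phi> (s + r) \<le> 4 * \<phi> s + \<psi> r"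
    using exists_strongly_convex_shift_majorant[OF assms(1), of 4]
      eventually_shift_le[OF assms(2) _ assms(5)] by auto
  have mult: "(\<lambda>z. g z * f z) \<in> ?X" if "g \<in> hardy_orlicz (comp_log \<psi>)" "f \<in> ?X" for f g
    using hardy_orlicz_mult[OF assms(1) \<psi>(1) _ \<psi>(2) that(2,1)] by simp
  have "g holomorphic_on unit_disk" if "g \<in> hardy_orlicz (comp_log \<psi>)" for g
    using that by (simp add: hardy_orlicz_def smirnov_class_def)
  with mult have sub: "hardy_orlicz (comp_log \<psi>) \<subseteq> multipliers ?X"
    unfolding multipliers_def by blast
  have "function_algebra (multipliers ?X)"
  proof (rule function_algebra_multipliers)
    \<comment> \<open>Constants lie in the class of \<psi>, because the circle has finite measure,
      and that class consists of multipliers.\<close>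
    show "(\<lambda>z. c) \<in> multipliers ?X" for c
      using sub hardy_orlicz_const by blast
    \<comment> \<open>The doubling required by \<open>hardy_orlicz_add\<close> is multiplication by
      the constant 2, again an element of the class of \<psi>.\<close>
    show "(\<lambda>z. f z + g z) \<in> ?X" if "f \<in> ?X" "g \<in> ?X" for f g
      using hardy_orlicz_add[OF assms(1) _ that] mult[OF hardy_orlicz_const] by blast
  qed
  \<comment> \<open>The generated algebra is contained in every algebra that contains the class of
    \<psi>.\<close>
  then have "generated_algebra (hardy_orlicz (comp_log \<psi>)) \<subseteq> multipliers ?X"
    unfolding generated_algebra_def using sub by (rule hull_minimal[rotated])
  with \<psi>(1) show ?thesis by blast
qed

end
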